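(* For non-zero elements $a,b\in\mathbb C^n$ the vector space $$\mathcal E(a,b)=\{\phi_v(g)=\mathrm{trace}(a^tv(x+iy)^t+b^tv(z+iw)^t)\ |\ v\in\mathbb C^n\}$$ of functions on $\mathrm{Sp}(n,\mathbb R)$ is an eigenfamily on $\mathrm{Sp}(n,\mathbb R)$, where $x,y,z,w\in\mathbb R^{n\times n}$ denote the blocks of $g=\begin{pmatrix} x& y\\ z& w\end{pmatrix}\in\mathrm{Sp}(n,\mathbb R)$.
   Context: Elements of $\mathbb C^n$ are row vectors, so $a^tv$ is the $n\times n$ matrix with entries $a_iv_j$. $\mathrm{Sp}(n,\mathbb R)=\{g\in\mathrm{SL}_{2n}(\mathbb R)\ |\ gJ_ng^t=J_n\}$ with $J_n=\begin{pmatrix}0&I_n\\-I_n&0\end{pmatrix}$. It carries its standard left-invariant Riemannian metric, induced by the scalar product $g(Z,W)=\mathrm{Re}\,\mathrm{trace}(ZW^* )$ on its Lie algebra. For complex valued functions $\phi,\psi$ on a Lie group with left-invariant Riemannian metric, the Laplacian (tension field) $\tau$ and the operator $\kappa(\phi,\psi)=g(\mathrm{grad}(\phi),\mathrm{grad}(\psi))$ ($g$ extended complex bilinearly) are given by $\tau(\phi)=\sum_{Z\in\mathcal B}Z^2(\phi)$ and $\kappa(\phi,\psi)=\sum_{Z\in\mathcal B}Z(\phi)Z(\psi)$, where $\mathcal B$ is any orthonormal basis of the Lie algebra of left-invariant vector fields, $Z(\phi)(p)=\frac{d}{ds}[\phi(p\cdot\exp(sZ))]|_{s=0}$ and $Z^2(\phi)(p)=\frac{d^2}{ds^2}[\phi(p\cdot\exp(sZ))]|_{s=0}$.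 A set $\mathcal E$ of complex valued functions is an eigenfamily if there exist $\lambda,\mu\in\mathbb C$ with $\tau(\phi)=\lambda\phi$ and $\kappa(\phi,\psi)=\mu\phi\psi$ for all $\phi,\psi\in\mathcal E$. *)

theory Defs
  imports "HOL-Analysis.Analysis" "HOL-Library.FuncSet"
begin

section \<open>Matrix Lie groups with the metric Re trace(Z W*)\<close>

text \<open>The type \<^typ>\<open>real^'m^'m\<close> is not an instance of the class of normed algebras for
  the product \<open>**\<close> (its \<open>*\<close> is componentwise), so the library's \<open>exp\<close> is not available here.\<close>

definition matrix_exp :: "real^'m^'m \<Rightarrow> real^'m^'m" where
  "matrix_exp Z = (\<Sum>k. (1 / fact k) *\<^sub>R (((\<lambda>M. Z ** M) ^^ k) (mat 1)))"

definition lie_algebra :: "(real^'m^'m) set \<Rightarrow> (real^'m^'m) set" where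
  "lie_algebra G = {Z. \<forall>t::real. matrix_exp (t *\<^sub>R Z) \<in> G}"

text \<open>For real matrices \<open>W*\<close> is the transpose and the real part is redundant.\<close>

definition lie_metric :: "real^'m^'m \<Rightarrow> real^'m^'m \<Rightarrow> real" where
  "lie_metric Z W = trace (Z ** transpose W)"

definition lie_orthonormal_basis :: "(real^'m^'m) set \<Rightarrow> (real^'m^'m) set \<Rightarrow> bool" where
  "lie_orthonormal_basis G B \<longleftrightarrow>
     (\<forall>Z\<in>B. \<forall>W\<in>B. lie_metric Z W = (if Z = W then 1 else 0)) \<and> span B = lie_algebra G"

definition lie_basis :: "(real^'m^'m) set \<Rightarrow> (real^'m^'m) set" where
  "lie_basis G = (SOME B. lie_orthonormal_basis G B)"

text \<open>A function on \<open>G\<close> is a function on the ambient matrix space of which only the values on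
  \<open>G\<close> matter: for \<open>p \<in> G\<close> and \<open>Z \<in> lie_algebra G\<close> the following curves stay in \<open>G\<close>.\<close>

definition lie_curve :: "real^'m^'m \<Rightarrow> real^'m^'m \<Rightarrow> real \<Rightarrow> real^'m^'m" where
  "lie_curve p Z s = p ** matrix_exp (s *\<^sub>R Z)"

definition lie_deriv :: "real^'m^'m \<Rightarrow> (real^'m^'m \<Rightarrow> complex) \<Rightarrow> real^'m^'m \<Rightarrow> complex" where
  "lie_deriv Z \<phi> p = vector_derivative (\<lambda>s. \<phi> (lie_curve p Z s)) (at 0)"

definition lie_deriv2 :: "real^'m^'m \<Rightarrow> (real^'m^'m \<Rightarrow> complex) \<Rightarrow> real^'m^'m \<Rightarrow> complex" where
  "lie_deriv2 Z \<phi> p =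
     vector_derivative (\<lambda>s. vector_derivative (\<lambda>r. \<phi> (lie_curve p Z r)) (at s)) (at 0)"

text \<open>\<^const>\<open>vector_derivative\<close> is unspecified where no derivative exists, so
  the existence of the derivatives above is recorded separately.\<close>

definition twice_lie_differentiable :: "(real^'m^'m) set \<Rightarrow> (real^'m^'m \<Rightarrow> complex) \<Rightarrow> bool" where
  "twice_lie_differentiable G \<phi> \<longleftrightarrow>
     (\<forall>p\<in>G. \<forall>Z\<in>lie_algebra G.
        (\<forall>s. (\<lambda>r. \<phi> (lie_curve p Z r)) differentiable (at s)) \<and>
        (\<lambda>s. vector_derivative (\<lambda>r. \<phi> (lie_curve p Z r)) (at s)) differentiable (at 0))"

text \<open>For smooth functions the following two sums do not depend on the choice of the
  orthonormal basis.\<close>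

definition tension :: "(real^'m^'m) set \<Rightarrow> (real^'m^'m \<Rightarrow> complex) \<Rightarrow> real^'m^'m \<Rightarrow> complex" where
  "tension G \<phi> p = (\<Sum>Z\<in>lie_basis G. lie_deriv2 Z \<phi> p)"

definition conformality ::
  "(real^'m^'m) set \<Rightarrow> (real^'m^'m \<Rightarrow> complex) \<Rightarrow> (real^'m^'m \<Rightarrow> complex) \<Rightarrow> real^'m^'m \<Rightarrow> complex" where
  "conformality G \<phi> \<psi> p = (\<Sum>Z\<in>lie_basis G. lie_deriv Z \<phi> p * lie_deriv Z \<psi> p)"

definition eigenfamily_on :: "(real^'m^'m) set \<Rightarrow> (real^'m^'m \<Rightarrow> complex) set \<Rightarrow> bool" where
  "eigenfamily_on G F \<longleftrightarrow>
     (\<forall>\<phi>\<in>F. twice_lie_differentiable G \<phi>) \<and>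
     (\<exists>l m :: complex.
        (\<forall>\<phi>\<in>F. \<forall>p\<in>G. tension G \<phi> p = l * \<phi> p) \<and>
        (\<forall>\<phi>\<in>F. \<forall>\<psi>\<in>F. \<forall>p\<in>G. conformality G \<phi> \<psi> p = m * \<phi> p * \<psi> p))"

text \<open>Complex vector spaces of functions on \<open>G\<close>, in the \<^const>\<open>extensional\<close> encoding.\<close>

definition function_space_on :: "'a set \<Rightarrow> ('a \<Rightarrow> complex) set \<Rightarrow> bool" where
  "function_space_on G F \<longleftrightarrow>
     F \<subseteq> extensional G \<and>
     (\<lambda>p\<in>G. 0) \<in> F \<and>
     (\<forall>\<phi>\<in>F. \<forall>\<psi>\<in>F. (\<lambda>p\<in>G. \<phi> p + \<psi> p) \<in> F) \<and>
     (\<forall>c. \<forall>\<phi>\<in>F. (\<lambda>p\<in>G. c * \<phi> p) \<in> F)"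


section \<open>The group Sp(n,R) and the functions on it\<close>

text \<open>Rows and columns of a \<open>2n \<times> 2n\<close> matrix are indexed by \<open>'n + 'n\<close>; \<^const>\<open>Inl\<close> is the first
  half of the indices.\<close>

definition from_blocks ::
  "'a^'n^'n \<Rightarrow> 'a^'n^'n \<Rightarrow> 'a^'n^'n \<Rightarrow> 'a^'n^'n \<Rightarrow> 'a^('n + 'n)^('n + 'n)" where
  "from_blocks x y z w = (\<chi> i j. case (i, j) of
       (Inl k, Inl l) \<Rightarrow> x $ k $ l
     | (Inl k, Inr l) \<Rightarrow> y $ k $ l
     | (Inr k, Inl l) \<Rightarrow> z $ k $ l
     | (Inr k, Inr l) \<Rightarrow> w $ k $ l)"

definition block_x :: "'a^('n + 'n)^('n + 'n) \<Rightarrow> 'a^'n^'n" where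
  "block_x g = (\<chi> k l. g $ Inl k $ Inl l)"
definition block_y :: "'a^('n + 'n)^('n + 'n) \<Rightarrow> 'a^'n^'n" where
  "block_y g = (\<chi> k l. g $ Inl k $ Inr l)"
definition block_z :: "'a^('n + 'n)^('n + 'n) \<Rightarrow> 'a^'n^'n" where
  "block_z g = (\<chi> k l. g $ Inr k $ Inl l)"
definition block_w :: "'a^('n + 'n)^('n + 'n) \<Rightarrow> 'a^'n^'n" where
  "block_w g = (\<chi> k l. g $ Inr k $ Inr l)"

definition J_mat :: "real^('n::finite + 'n)^('n + 'n)" where
  "J_mat = from_blocks 0 (mat 1) (- mat 1) 0"

definition Sp_real :: "(real^('n::finite + 'n)^('n + 'n)) set" where
  "Sp_real = {g. det g = 1 \<and> g ** J_mat ** transpose g = J_mat}"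

definition complex_matrix :: "real^'n^'n \<Rightarrow> real^'n^'n \<Rightarrow> complex^'n^'n" where
  "complex_matrix x y = (\<chi> k l. Complex (x $ k $ l) (y $ k $ l))"

text \<open>The matrix \<open>a\<^sup>t v\<close> of two row vectors.\<close>

definition outer :: "complex^'n \<Rightarrow> complex^'n \<Rightarrow> complex^'n^'n" where
  "outer a v = (\<chi> i j. a $ i * v $ j)"

definition \<phi>_Sp ::
  "complex^'n::finite \<Rightarrow> complex^'n \<Rightarrow> complex^'n \<Rightarrow> real^('n + 'n)^('n + 'n) \<Rightarrow> complex" where
  "\<phi>_Sp a b v = (\<lambda>g\<in>Sp_real.
     trace (outer a v ** transpose (complex_matrix (block_x g) (block_y g)) +
            outer b v ** transpose (complex_matrix (block_z g) (block_w g))))"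

definition \<E>_Sp ::
  "complex^'n::finite \<Rightarrow> complex^'n \<Rightarrow> (real^('n + 'n)^('n + 'n) \<Rightarrow> complex) set" where
  "\<E>_Sp a b = {\<phi>_Sp a b v | v. True}"

end

theory Submission imports Defs begin

text \<open>
  On \<open>Sp(n,R)\<close> the function \<open>\<phi>\<^sub>v\<close> is the restriction of a linear form on all matrices,
  \<open>\<phi>\<^sub>v(g) = \<alpha> g \<nu>\<^sup>t\<close> with \<open>\<alpha> = (a, b)\<close> and \<open>\<nu> = (v, iv)\<close> in \<open>C\<^bsup>2n\<^esup>\<close>.  Along the curve
  \<open>p exp(sZ)\<close> its first two derivatives at \<open>0\<close> are therefore \<open>\<alpha>pZ\<nu>\<^sup>t\<close> and \<open>\<alpha>pZ\<^sup>2\<nu>\<^sup>t\<close>, and both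
  operators are determined by the tensor \<open>\<Sum> Z\<^sub>i\<^sub>j Z\<^sub>k\<^sub>l\<close>, summed over an orthonormal basis of the
  Lie algebra.

  This tensor is the matrix of the orthogonal projection onto the Lie algebra.  The
  algebra consists of the fixed points of the isometric involution \<open>M \<mapsto> J M\<^sup>t J\<close>
  (\<open>lie_algebra_Sp_real\<close>), so the projection is \<open>M \<mapsto> (M + J M\<^sup>t J) / 2\<close> and the tensor equals
  \<open>(\<delta>\<^sub>i\<^sub>k \<delta>\<^sub>j\<^sub>l + J\<^sub>k\<^sub>j J\<^sub>i\<^sub>l) / 2\<close> (\<open>orthonormal_sum_entries\<close>).

  Contracting \<open>j\<close> with \<open>k\<close> gives \<open>\<Sum> Z\<^sup>2 = I / 2\<close>, whence \<open>\<tau>(\<phi>\<^sub>v) = \<phi>\<^sub>v / 2\<close>.  For \<open>\<kappa>(\<phi>\<^sub>v, \<phi>\<^sub>w)\<close>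
  put \<open>\<beta> = \<alpha>p\<close>; the tensor is contracted with \<open>\<beta>, \<nu>, \<beta>, \<omega>\<close>, where \<open>\<omega> = (w, iw)\<close>
  (\<open>orthonormal_sum_pairing\<close>).  The vectors \<open>(v, iv)\<close> are isotropic for the bilinear dot
  product, which kills the first term, and they are eigenvectors of \<open>J\<close> with eigenvalue
  \<open>i\<close>, so the second term is \<open>(i \<beta>\<nu>\<^sup>t)(i \<beta>\<omega>\<^sup>t) / 2\<close>.  Hence \<open>\<kappa>(\<phi>\<^sub>v, \<phi>\<^sub>w) = - \<phi>\<^sub>v \<phi>\<^sub>w / 2\<close>: the
  eigenvalues are \<open>\<lambda> = 1/2\<close> and \<open>\<mu> = -1/2\<close>.
\<close>

section \<open>The matrix exponential and its derivative\<close>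

lemma bounded_bilinear_matrix_mult:
  "bounded_bilinear ((**) :: real^'n^'m \<Rightarrow> real^'p^'n \<Rightarrow> real^'p^'m)"
  unfolding bilinear_conv_bounded_bilinear[symmetric] bilinear_def
  by (auto intro!: linearI simp: matrix_add_ldistrib vec_eq_iff matrix_matrix_mult_def
      sum.distrib sum_distrib_left algebra_simps)

lemmas matrix_mult_add_left = bounded_bilinear.add_left[OF bounded_bilinear_matrix_mult]
lemmas matrix_mult_add_right = bounded_bilinear.add_right[OF bounded_bilinear_matrix_mult]
lemmas matrix_mult_diff_left = bounded_bilinear.diff_left[OF bounded_bilinear_matrix_mult]
lemmas matrix_mult_minus_left = bounded_bilinear.minus_left[OF bounded_bilinear_matrix_mult]
lemmas matrix_mult_minus_right = bounded_bilinear.minus_right[OF bounded_bilinear_matrix_mult]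
lemmas matrix_mult_scaleR_left = bounded_bilinear.scaleR_left[OF bounded_bilinear_matrix_mult]
lemmas matrix_mult_scaleR_right = bounded_bilinear.scaleR_right[OF bounded_bilinear_matrix_mult]

lemma bounded_linear_transpose:
  "bounded_linear (transpose :: real^'n^'m \<Rightarrow> real^'m^'n)"
  unfolding linear_conv_bounded_linear[symmetric]
  by (auto intro!: linearI simp: vec_eq_iff transpose_def)

abbreviation matrix_power :: "real^'m^'m \<Rightarrow> nat \<Rightarrow> real^'m^'m" where
  "matrix_power Z k \<equiv> ((\<lambda>M. Z ** M) ^^ k) (mat 1)"

lemma matrix_power_Suc_right: "matrix_power Z (Suc k) = matrix_power Z k ** Z"
  by (induction k) (simp_all add: matrix_mul_assoc)

lemma matrix_power_scaleR: "matrix_power (t *\<^sub>R Z) k = t ^ k *\<^sub>R matrix_power Z k"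
  by (induction k)
     (simp_all add: matrix_mult_scaleR_left matrix_mult_scaleR_right mult.commute)

text \<open>The entrywise \<open>l\<^sup>1\<close> norm is submultiplicative and dominates every entry, which is all
  that the convergence of the exponential series entry by entry needs.\<close>

lemma matrix_power_entry_bound:
  fixes Z :: "real^'m^'m"
  shows "\<bar>matrix_power Z k $ i $ j\<bar> \<le> (\<Sum>i\<in>UNIV. \<Sum>j\<in>UNIV. \<bar>Z $ i $ j\<bar>) ^ k"
proof (induction k arbitrary: i)
  case 0
  show ?case by (simp add: mat_def)
next
  case (Suc k)
  let ?S = "\<Sum>i\<in>UNIV. \<Sum>j\<in>UNIV. \<bar>Z $ i $ j\<bar>"
  have S0: "0 \<le> ?S" by (intro sum_nonneg) simp
  have "\<bar>matrix_power Z (Suc k) $ i $ j\<bar> \<le> (\<Sum>l\<in>UNIV. \<bar>Z $ i $ l\<bar> * \<bar>matrix_power Z k $ l $ j\<bar>)"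
    by (simp add: matrix_matrix_mult_def abs_mult[symmetric] del: abs_mult)
  also have "\<dots> \<le> (\<Sum>l\<in>UNIV. \<bar>Z $ i $ l\<bar> * ?S ^ k)"
    by (intro sum_mono mult_left_mono Suc.IH) simp
  also have "\<dots> = (\<Sum>l\<in>UNIV. \<bar>Z $ i $ l\<bar>) * ?S ^ k"
    by (simp add: sum_distrib_right)
  also have "\<dots> \<le> ?S * ?S ^ k"
    using S0 by (intro mult_right_mono member_le_sum) (auto intro: sum_nonneg)
  finally show ?case by simp
qed

lemma matrix_power_entry_summable:
  "summable (\<lambda>k. (matrix_power Z k $ i $ j / fact k) * t ^ k)"
proof (rule summable_comparison_test'[where N = 0])
  let ?S = "\<Sum>i\<in>UNIV. \<Sum>j\<in>UNIV. \<bar>Z $ i $ j\<bar>"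
  show "summable (\<lambda>k. inverse (fact k) * (?S * \<bar>t\<bar>) ^ k)"
    by (rule summable_exp)
  show "norm ((matrix_power Z k $ i $ j / fact k) * t ^ k) \<le> inverse (fact k) * (?S * \<bar>t\<bar>) ^ k" for k
    using mult_right_mono[OF matrix_power_entry_bound[where Z = Z and k = k and i = i and j = j],
        of "inverse (fact k) * \<bar>t\<bar> ^ k"]
    by (simp add: abs_mult power_abs field_simps power_mult_distrib)
qed

text \<open>Each entry of \<open>exp(tZ)\<close> is a scalar power series in \<open>t\<close>, so differentiation of power
  series on the real line applies.\<close>

lemma matrix_exp_entry:
  "matrix_exp (t *\<^sub>R Z) $ i $ j = (\<Sum>k. (matrix_power Z k $ i $ j / fact k) * t ^ k)"
proof -
  have "(\<lambda>k. (1 / fact k) *\<^sub>R matrix_power (t *\<^sub>R Z) k) sums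
        (\<chi> i j. \<Sum>k. (matrix_power Z k $ i $ j / fact k) * t ^ k)"
    unfolding sums_def
  proof (intro vec_tendstoI)
    fix i j
    have "(\<lambda>k. (matrix_power Z k $ i $ j / fact k) * t ^ k) sums
          (\<Sum>k. (matrix_power Z k $ i $ j / fact k) * t ^ k)"
      by (rule summable_sums[OF matrix_power_entry_summable])
    then show "(\<lambda>n. (\<Sum>k<n. (1 / fact k) *\<^sub>R matrix_power (t *\<^sub>R Z) k) $ i $ j) \<longlonglongrightarrow>
        (\<chi> i j. \<Sum>k. (matrix_power Z k $ i $ j / fact k) * t ^ k) $ i $ j"
      by (simp add: sums_def matrix_power_scaleR mult.commute)
  qed
  then show ?thesis
    unfolding matrix_exp_def by (simp add: sums_unique[symmetric])
qed

lemma matrix_exp_0: "matrix_exp 0 = (mat 1 :: real^'m^'m)"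
proof -
  have "matrix_exp 0 $ i $ j = mat 1 $ i $ j" for i j :: 'm
  proof -
    let ?c = "\<lambda>k. matrix_power (0 :: real^'m^'m) k $ i $ j / fact k"
    have "matrix_exp 0 $ i $ j = (\<Sum>k. ?c k * 0 ^ k)"
      using matrix_exp_entry[of 0 "0 :: real^'m^'m" i j] by (simp only: scale_zero_left)
    also have "\<dots> = ?c 0" by (rule powser_zero)
    finally show ?thesis by simp
  qed
  then show ?thesis by (simp add: vec_eq_iff)
qed

lemma has_vector_derivative_matrixI:
  fixes f :: "real \<Rightarrow> real^'n^'m"
  assumes "\<And>i j. ((\<lambda>t. f t $ i $ j) has_field_derivative D $ i $ j) (at t)"
  shows "(f has_vector_derivative D) (at t)"
  unfolding has_vector_derivative_def
proof (subst has_derivative_componentwise_within, rule ballI)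
  fix b :: "real^'n^'m" assume "b \<in> Basis"
  then obtain i j where b: "b = axis i (axis j 1)"
    by (auto simp: Basis_vec_def)
  show "((\<lambda>x. f x \<bullet> b) has_derivative (\<lambda>x. (x *\<^sub>R D) \<bullet> b)) (at t)"
    using assms[of i j] unfolding b has_field_derivative_def
    by (simp add: inner_axis mult.commute[of _ "D $ i $ j"])
qed

lemma has_vector_derivative_matrix_exp:
  fixes Z :: "real^'m^'m"
  shows "((\<lambda>t. matrix_exp (t *\<^sub>R Z)) has_vector_derivative matrix_exp (t *\<^sub>R Z) ** Z) (at t)"
proof (rule has_vector_derivative_matrixI)
  fix i j
  let ?c = "\<lambda>j k. matrix_power Z k $ i $ j / fact k"
  have "((\<lambda>t. \<Sum>k. ?c j k * t ^ k) has_field_derivative (\<Sum>k. diffs (?c j) k * t ^ k)) (at t)"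
    by (rule termdiffs_strong_converges_everywhere[OF matrix_power_entry_summable])
  moreover have "(\<Sum>k. diffs (?c j) k * t ^ k) = (matrix_exp (t *\<^sub>R Z) ** Z) $ i $ j"
  proof -
    have "diffs (?c j) k * t ^ k = (\<Sum>l\<in>UNIV. (?c l k * t ^ k) * Z $ l $ j)" for k
    proof -
      have "diffs (?c j) k = matrix_power Z (Suc k) $ i $ j / fact k"
        by (simp add: diffs_def divide_simps del: funpow.simps of_nat_Suc)
      also have "\<dots> = (\<Sum>l\<in>UNIV. ?c l k * Z $ l $ j)"
        unfolding matrix_power_Suc_right
        by (simp add: matrix_matrix_mult_def[of "matrix_power Z k"] sum_divide_distrib)
      finally show ?thesis by (simp add: sum_distrib_left sum_distrib_right ac_simps)
    qed
    moreover have "(\<lambda>k. \<Sum>l\<in>UNIV. (?c l k * t ^ k) * Z $ l $ j) sums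
        (\<Sum>l\<in>UNIV. matrix_exp (t *\<^sub>R Z) $ i $ l * Z $ l $ j)"
      unfolding matrix_exp_entry
      by (intro sums_sum sums_mult2 summable_sums matrix_power_entry_summable)
    ultimately show ?thesis by (simp add: sums_unique[symmetric] matrix_matrix_mult_def)
  qed
  ultimately show "((\<lambda>t. matrix_exp (t *\<^sub>R Z) $ i $ j) has_field_derivative
      (matrix_exp (t *\<^sub>R Z) ** Z) $ i $ j) (at t)"
    by (simp add: matrix_exp_entry)
qed

section \<open>Derivatives of restrictions of linear functions\<close>

lemma has_vector_derivative_lie_curve:
  "(lie_curve p Z has_vector_derivative lie_curve p Z s ** Z) (at s)"
  using bounded_linear.has_vector_derivative[OF
      bounded_bilinear.bounded_linear_right[OF bounded_bilinear_matrix_mult]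
      has_vector_derivative_matrix_exp[of Z s], of p]
  by (simp add: lie_curve_def[abs_def] matrix_mul_assoc)

lemma lie_curve_0: "lie_curve p Z 0 = p"
  by (simp add: lie_curve_def matrix_exp_0)

text \<open>If \<open>\<phi>\<close> is the restriction to \<open>G\<close> of a linear map \<open>L\<close>, then \<open>\<phi>(p exp(sZ)) = L(p exp(sZ))\<close>
  for all \<open>s\<close>, because the curve stays in the matrix group.\<close>

lemma
  assumes L: "bounded_linear L"
    and \<phi>: "\<And>g. g \<in> G \<Longrightarrow> \<phi> g = L g"
    and G: "\<And>g h. g \<in> G \<Longrightarrow> h \<in> G \<Longrightarrow> g ** h \<in> G"
  shows twice_lie_differentiable_linear: "twice_lie_differentiable G \<phi>"
    and lie_deriv_linear: "p \<in> G \<Longrightarrow> Z \<in> lie_algebra G \<Longrightarrow> lie_deriv Z \<phi> p = L (p ** Z)"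
    and lie_deriv2_linear: "p \<in> G \<Longrightarrow> Z \<in> lie_algebra G \<Longrightarrow> lie_deriv2 Z \<phi> p = L (p ** Z ** Z)"
proof -
  have 1: "((\<lambda>r. \<phi> (lie_curve p Z r)) has_vector_derivative L (lie_curve p Z s ** Z)) (at s)"
    if "p \<in> G" "Z \<in> lie_algebra G" for p Z s
  proof -
    have "lie_curve p Z r \<in> G" for r
      using that G by (auto simp: lie_curve_def lie_algebra_def)
    then have "(\<lambda>r. \<phi> (lie_curve p Z r)) = (\<lambda>r. L (lie_curve p Z r))"
      by (simp add: \<phi>)
    then show ?thesis
      using bounded_linear.has_vector_derivative[OF L has_vector_derivative_lie_curve[of p Z s]]
      by simp
  qed
  have 2: "((\<lambda>s. vector_derivative (\<lambda>r. \<phi> (lie_curve p Z r)) (at s)) has_vector_derivative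
      L (p ** Z ** Z)) (at 0)"
    if "p \<in> G" "Z \<in> lie_algebra G" for p Z
  proof -
    have "bounded_linear (\<lambda>M. L (M ** Z))"
      by (rule bounded_linear_compose[OF L
            bounded_bilinear.bounded_linear_left[OF bounded_bilinear_matrix_mult]])
    from bounded_linear.has_vector_derivative[OF this has_vector_derivative_lie_curve[of p Z 0]]
    show ?thesis
      by (simp add: vector_derivative_at[OF 1[OF that]] lie_curve_0)
  qed
  show "twice_lie_differentiable G \<phi>"
    unfolding twice_lie_differentiable_def
    using 1 2 by (blast intro: differentiableI_vector)
  show "lie_deriv Z \<phi> p = L (p ** Z)" if "p \<in> G" "Z \<in> lie_algebra G"
    unfolding lie_deriv_def using vector_derivative_at[OF 1[OF that]] by (simp add: lie_curve_0)
  show "lie_deriv2 Z \<phi> p = L (p ** Z ** Z)" if "p \<in> G" "Z \<in> lie_algebra G"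
    unfolding lie_deriv2_def using vector_derivative_at[OF 2[OF that]] .
qed

section \<open>The completeness relation of an orthonormal basis\<close>

lemma lie_metric_eq_inner: "lie_metric Z W = Z \<bullet> W"
  by (simp add: lie_metric_def trace_def matrix_matrix_mult_def transpose_def inner_vec_def)

lemma lie_basis_orthonormal:
  assumes "subspace (lie_algebra G)"
  shows "lie_orthonormal_basis G (lie_basis G)"
  unfolding lie_basis_def
proof (rule someI_ex)
  obtain B where "pairwise orthogonal B" "\<And>x. x \<in> B \<Longrightarrow> norm x = 1" "span B = lie_algebra G"
    using orthonormal_basis_subspace[OF assms] by metis
  then have "lie_orthonormal_basis G B"
    by (auto simp: lie_orthonormal_basis_def lie_metric_eq_inner pairwise_def orthogonal_def
        dot_square_norm)
  then show "\<exists>B. lie_orthonormal_basis G B" ..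
qed

text \<open>The involution \<open>M \<mapsto> J M\<^sup>t J\<close> is self-adjoint: this is invariance of the trace under
  transposition and cyclic permutation, with the two signs from \<open>J\<^sup>t = -J\<close> cancelling.\<close>

lemma inner_reflection:
  fixes J :: "real^'m^'m"
  assumes "transpose J = - J"
  shows "(J ** transpose M ** J) \<bullet> Z = M \<bullet> (J ** transpose Z ** J)"
proof -
  have "M \<bullet> (J ** transpose Z ** J) = trace ((M ** J ** Z) ** J)"
    unfolding lie_metric_eq_inner[symmetric] lie_metric_def
    by (simp add: matrix_transpose_mul assms matrix_mult_minus_left matrix_mult_minus_right
        matrix_mul_assoc)
  also have "\<dots> = Z \<bullet> (J ** transpose M ** J)"
    unfolding lie_metric_eq_inner[symmetric] lie_metric_def
    by (simp add: matrix_transpose_mul assms matrix_mult_minus_left matrix_mult_minus_right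
        matrix_mul_assoc trace_mul_sym[of "M ** J ** Z"] trace_mul_sym[of "Z ** J"])
       (metis matrix_mul_assoc trace_mul_sym)
  finally show ?thesis by (simp add: inner_commute)
qed

text \<open>Both sides are the orthogonal projection of \<open>M\<close> onto the fixed space of \<open>M \<mapsto> J M\<^sup>t J\<close>:
  the average of \<open>M\<close> and its image is a fixed point, since \<open>J\<^sup>2 = -I\<close> makes this map an
  involution, and it has the same scalar products as
  \<open>M\<close> with all fixed points.\<close>

lemma orthonormal_sum_projection:
  fixes J :: "real^'m^'m"
  assumes J: "transpose J = - J" "J ** J = - mat 1"
    and B: "lie_orthonormal_basis G B" and G: "lie_algebra G = {Z. J ** transpose Z ** J = Z}"
  shows "(\<Sum>Z\<in>B. (M \<bullet> Z) *\<^sub>R Z) = (1/2) *\<^sub>R (M + J ** transpose M ** J)" (is "_ = ?P")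
proof -
  have orth: "pairwise orthogonal B" and unit: "\<And>Z. Z \<in> B \<Longrightarrow> norm Z = 1"
    and span: "span B = {Z. J ** transpose Z ** J = Z}"
    using B G by (auto simp: lie_orthonormal_basis_def lie_metric_eq_inner pairwise_def
        orthogonal_def norm_eq_1)
  have fin: "finite B"
    using orth unit pairwise_orthogonal_independent[of B] independent_imp_finite by force
  have JJ: "J ** (J ** X) = - X" for X
    by (simp add: matrix_mul_assoc J matrix_mult_minus_left)
  have "J ** transpose ?P ** J = ?P"
    by (simp add: transpose_scalar linear_add[OF bounded_linear.linear[OF bounded_linear_transpose]]
        matrix_transpose_mul J matrix_mult_scaleR_left
        matrix_mult_scaleR_right matrix_mult_add_left matrix_mult_add_right
        matrix_mult_diff_left
        matrix_mult_minus_left matrix_mult_minus_right JJ matrix_mul_assoc[symmetric])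
  then have "?P \<in> span B" by (simp add: span)
  have "M \<bullet> Z = ?P \<bullet> Z" if "Z \<in> B" for Z
  proof -
    have "J ** transpose Z ** J = Z"
      using span_base[OF that] span by simp
    then show ?thesis
      by (simp add: inner_add_left inner_reflection[OF J(1)])
  qed
  then have "(\<Sum>Z\<in>B. (M \<bullet> Z) *\<^sub>R Z) = (\<Sum>Z\<in>B. (?P \<bullet> Z) *\<^sub>R Z)"
    by (intro sum.cong) auto
  also have "\<dots> = ?P"
    by (rule orthonormal_basis_expand[OF orth unit \<open>?P \<in> span B\<close> fin])
  finally show ?thesis .
qed

text \<open>The projection of the matrix unit at \<open>(i, j)\<close>, read off at the entry \<open>(k, l)\<close>.\<close>

lemma orthonormal_sum_entries:
  fixes J :: "real^'m^'m"
  assumes "transpose J = - J" "J ** J = - mat 1"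
    "lie_orthonormal_basis G B" "lie_algebra G = {Z. J ** transpose Z ** J = Z}"
  shows "(\<Sum>Z\<in>B. Z $ i $ j * Z $ k $ l) =
    (1/2) * ((if i = k \<and> j = l then 1 else 0) + J $ k $ j * J $ i $ l)"
proof -
  define E :: "real^'m^'m" where "E = (\<chi> p q. if p = i \<and> q = j then 1 else 0)"
  have E_inner: "E \<bullet> Z = Z $ i $ j" for Z
  proof -
    have "E \<bullet> Z = (\<Sum>p\<in>UNIV. if p = i then \<Sum>q\<in>UNIV. if q = j then Z $ p $ q else 0 else 0)"
      unfolding inner_vec_def E_def
      by (intro sum.cong refl) (simp add: if_distrib[where f = "\<lambda>x. x * _"] cong: if_cong)
    then show ?thesis by simp
  qed
  have "(J ** transpose E) $ k $ p = (if p = i then J $ k $ j else 0)" for p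
  proof -
    have "(J ** transpose E) $ k $ p = (\<Sum>q\<in>UNIV. if q = j then if p = i then J $ k $ q else 0 else 0)"
      unfolding matrix_matrix_mult_def transpose_def E_def
      by (auto simp: if_distrib[where f = "\<lambda>x. _ * x"] cong: if_cong)
    then show ?thesis by simp
  qed
  then have "(J ** transpose E ** J) $ k $ l = (\<Sum>p\<in>UNIV. (if p = i then J $ k $ j else 0) * J $ p $ l)"
    by (simp add: matrix_matrix_mult_def[of "J ** transpose E"])
  also have "\<dots> = (\<Sum>p\<in>UNIV. if p = i then J $ k $ j * J $ p $ l else 0)"
    by (intro sum.cong) auto
  finally have "(J ** transpose E ** J) $ k $ l = J $ k $ j * J $ i $ l"
    by simp
  moreover have "(\<Sum>Z\<in>B. (E \<bullet> Z) *\<^sub>R Z) $ k $ l =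
      ((1/2) *\<^sub>R (E + J ** transpose E ** J)) $ k $ l"
    by (simp only: orthonormal_sum_projection[OF assms])
  ultimately show ?thesis
    by (auto simp: E_inner) (auto simp: E_def)
qed

lemma orthonormal_sum_square:
  fixes J :: "real^'m^'m"
  assumes "transpose J = - J" "J ** J = - mat 1"
    "lie_orthonormal_basis G B" "lie_algebra G = {Z. J ** transpose Z ** J = Z}"
  shows "(\<Sum>Z\<in>B. Z ** Z) = (1/2) *\<^sub>R mat 1"
proof -
  \<comment> \<open>Setting \<open>k = j\<close> in the completeness relation leaves the diagonal entry \<open>J\<^sub>j\<^sub>j = 0\<close>.\<close>
  have diag: "J $ j $ j = 0" for j
    using arg_cong[OF assms(1), of "\<lambda>M. M $ j $ j"] by (simp add: transpose_def)
  have "(\<Sum>Z\<in>B. Z ** Z) $ i $ l = ((1/2) *\<^sub>R mat 1) $ i $ l" for i l :: 'm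
  proof -
    have "(\<Sum>Z\<in>B. Z ** Z) $ i $ l = (\<Sum>j\<in>UNIV. \<Sum>Z\<in>B. Z $ i $ j * Z $ j $ l)"
      unfolding matrix_matrix_mult_def by (simp add: sum.swap[where A = B])
    also have "\<dots> = (\<Sum>j\<in>UNIV. if j = i then if i = l then 1/2 else 0 else 0)"
      unfolding orthonormal_sum_entries[OF assms] by (intro sum.cong) (auto simp: diag)
    finally show ?thesis by (simp add: mat_def)
  qed
  then show ?thesis by (simp add: vec_eq_iff)
qed

section \<open>Contracting the completeness relation with vectors\<close>

text \<open>The value \<open>\<alpha> M \<nu>\<^sup>t\<close> for row vectors \<open>\<alpha>\<close>, \<open>\<nu>\<close>, bilinear without complex conjugation.\<close>

definition matrix_pairing :: "complex^'m \<Rightarrow> complex^'n \<Rightarrow> real^'n^'m \<Rightarrow> complex" where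
  "matrix_pairing \<alpha> \<nu> M = (\<Sum>i\<in>UNIV. \<Sum>j\<in>UNIV. \<alpha> $ i * of_real (M $ i $ j) * \<nu> $ j)"

lemma bounded_linear_matrix_pairing: "bounded_linear (matrix_pairing \<alpha> \<nu>)"
  unfolding linear_conv_bounded_linear[symmetric] matrix_pairing_def[abs_def]
  by (auto intro!: linearI simp: algebra_simps sum.distrib
      scaleR_conv_of_real[where 'a = complex] sum_distrib_left)

lemma matrix_pairing_mult:
  "matrix_pairing \<alpha> \<nu> (p ** M) = matrix_pairing (\<chi> k. \<Sum>i\<in>UNIV. \<alpha> $ i * of_real (p $ i $ k)) \<nu> M"
proof -
  let ?t = "\<lambda>i j k. \<alpha> $ i * of_real (p $ i $ k) * of_real (M $ k $ j) * \<nu> $ j"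
  have "matrix_pairing \<alpha> \<nu> (p ** M) = (\<Sum>i\<in>UNIV. \<Sum>j\<in>UNIV. \<Sum>k\<in>UNIV. ?t i j k)"
    by (simp add: matrix_pairing_def matrix_matrix_mult_def sum_distrib_left sum_distrib_right mult.assoc)
  also have "\<dots> = (\<Sum>i\<in>UNIV. \<Sum>k\<in>UNIV. \<Sum>j\<in>UNIV. ?t i j k)"
    by (intro sum.cong refl sum.swap)
  also have "\<dots> = (\<Sum>k\<in>UNIV. \<Sum>i\<in>UNIV. \<Sum>j\<in>UNIV. ?t i j k)"
    by (rule sum.swap)
  also have "\<dots> = (\<Sum>k\<in>UNIV. \<Sum>j\<in>UNIV. \<Sum>i\<in>UNIV. ?t i j k)"
    by (intro sum.cong refl sum.swap)
  finally show ?thesis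
    by (simp add: matrix_pairing_def sum_distrib_right)
qed

lemma orthonormal_sum_pairing:
  fixes J :: "real^'m^'m"
  assumes "transpose J = - J" "J ** J = - mat 1"
    "lie_orthonormal_basis G B" "lie_algebra G = {Z. J ** transpose Z ** J = Z}"
  shows "(\<Sum>Z\<in>B. matrix_pairing \<beta> \<nu> Z * matrix_pairing \<gamma> \<omega> Z) =
    (1/2) * ((\<Sum>i\<in>UNIV. \<beta> $ i * \<gamma> $ i) * (\<Sum>i\<in>UNIV. \<nu> $ i * \<omega> $ i) +
             matrix_pairing \<gamma> \<nu> J * matrix_pairing \<beta> \<omega> J)"
proof -
  let ?c = "\<lambda>i k j l. \<beta> $ i * \<gamma> $ k * (\<nu> $ j * \<omega> $ l)"
  let ?d = "\<lambda>i k j l. (\<beta> $ i * of_real (J $ i $ l) * \<omega> $ l) * (\<gamma> $ k * of_real (J $ k $ j) * \<nu> $ j)"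
  have "matrix_pairing \<beta> \<nu> Z * matrix_pairing \<gamma> \<omega> Z =
    (\<Sum>i\<in>UNIV. \<Sum>k\<in>UNIV. \<Sum>j\<in>UNIV. \<Sum>l\<in>UNIV. ?c i k j l * of_real (Z $ i $ j * Z $ k $ l))" for Z
    unfolding matrix_pairing_def sum_product by (intro sum.cong refl) simp
  then have "(\<Sum>Z\<in>B. matrix_pairing \<beta> \<nu> Z * matrix_pairing \<gamma> \<omega> Z) =
    (\<Sum>Z\<in>B. \<Sum>i\<in>UNIV. \<Sum>k\<in>UNIV. \<Sum>j\<in>UNIV. \<Sum>l\<in>UNIV. ?c i k j l * of_real (Z $ i $ j * Z $ k $ l))"
    by simp
  also have "\<dots> = (\<Sum>i\<in>UNIV. \<Sum>k\<in>UNIV. \<Sum>j\<in>UNIV. \<Sum>l\<in>UNIV.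
      \<Sum>Z\<in>B. ?c i k j l * of_real (Z $ i $ j * Z $ k $ l))"
    by (simp only: sum.swap[where A = B])
  also have "\<dots> = (\<Sum>i\<in>UNIV. \<Sum>k\<in>UNIV. \<Sum>j\<in>UNIV. \<Sum>l\<in>UNIV.
      ?c i k j l * of_real (\<Sum>Z\<in>B. Z $ i $ j * Z $ k $ l))"
    by (simp only: sum_distrib_left of_real_sum)
  also have "\<dots> = (\<Sum>i\<in>UNIV. \<Sum>k\<in>UNIV. \<Sum>j\<in>UNIV. \<Sum>l\<in>UNIV.
      (1/2) * ((if k = i then if l = j then ?c i i j j else 0 else 0) + ?d i k j l))"
    unfolding orthonormal_sum_entries[OF assms]
    by (intro sum.cong refl) (auto simp: algebra_simps)
  also have "\<dots> = (1/2) * ((\<Sum>i\<in>UNIV. \<Sum>k\<in>UNIV. \<Sum>j\<in>UNIV. \<Sum>l\<in>UNIV.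
        if k = i then if l = j then ?c i i j j else 0 else 0) +
      (\<Sum>i\<in>UNIV. \<Sum>k\<in>UNIV. \<Sum>j\<in>UNIV. \<Sum>l\<in>UNIV. ?d i k j l))"
    by (simp only: sum.distrib sum_distrib_left[symmetric])
  also have "(\<Sum>i\<in>UNIV. \<Sum>k\<in>UNIV. \<Sum>j\<in>UNIV. \<Sum>l\<in>UNIV.
        if k = i then if l = j then ?c i i j j else 0 else 0) =
      (\<Sum>i\<in>UNIV. \<Sum>k\<in>UNIV. if k = i then \<Sum>j\<in>UNIV. \<Sum>l\<in>UNIV. if l = j then ?c i i j j else 0 else 0)"
    by (intro sum.cong refl) simp
  also have "\<dots> = (\<Sum>i\<in>UNIV. \<beta> $ i * \<gamma> $ i) * (\<Sum>i\<in>UNIV. \<nu> $ i * \<omega> $ i)"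
    by (simp add: sum_product)
  also have "(\<Sum>i\<in>UNIV. \<Sum>k\<in>UNIV. \<Sum>j\<in>UNIV. \<Sum>l\<in>UNIV. ?d i k j l) =
      (\<Sum>i\<in>UNIV. \<Sum>k\<in>UNIV. \<Sum>l\<in>UNIV. \<Sum>j\<in>UNIV. ?d i k j l)"
    by (intro sum.cong refl sum.swap)
  also have "\<dots> = matrix_pairing \<beta> \<omega> J * matrix_pairing \<gamma> \<nu> J"
    unfolding matrix_pairing_def sum_product ..
  finally show ?thesis by (simp only: mult.commute)
qed

section \<open>The Lie algebra of the real symplectic group\<close>

lemma sum_UNIV_Plus:
  "(\<Sum>i\<in>UNIV. f i) = (\<Sum>k\<in>UNIV. f (Inl k)) + (\<Sum>k\<in>UNIV. f (Inr k))"
  for f :: "'m::finite + 'n::finite \<Rightarrow> 'a::comm_monoid_add"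
  using sum.Plus[of "UNIV :: 'm set" "UNIV :: 'n set" f] by simp

lemma J_mat_entries:
  "J_mat $ Inl k $ Inl l = 0" "J_mat $ Inl k $ Inr l = (if k = l then 1 else 0)"
  "J_mat $ Inr k $ Inl l = (if k = l then - 1 else 0)" "J_mat $ Inr k $ Inr l = 0"
  by (simp_all add: J_mat_def from_blocks_def mat_def)

lemma transpose_J_mat: "transpose J_mat = - (J_mat :: real^('n::finite + 'n)^('n + 'n))"
proof -
  have "transpose J_mat $ i $ j = (- J_mat) $ i $ j" for i j :: "'n + 'n"
    by (cases i; cases j) (simp_all add: transpose_def J_mat_entries)
  then show ?thesis by (simp add: vec_eq_iff)
qed

lemma J_mat_square: "J_mat ** J_mat = - (mat 1 :: real^('n::finite + 'n)^('n + 'n))"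
proof -
  have "(J_mat ** J_mat) $ i $ j = (- mat 1) $ i $ j" for i j :: "'n + 'n"
    by (cases i; cases j)
       (auto simp: matrix_matrix_mult_def J_mat_entries sum_UNIV_Plus mat_def
         if_distrib[where f = "\<lambda>x. x * _"] cong: if_cong)
  then show ?thesis by (simp add: vec_eq_iff)
qed

text \<open>Taking determinants in \<open>g J g\<^sup>t = J\<close> leaves the sign of \<open>det g\<close> open; along
  \<open>exp(tZ)\<close> continuity settles it.\<close>

lemma det_J_preserving:
  fixes g :: "real^('n::finite + 'n)^('n + 'n)"
  assumes "g ** J_mat ** transpose g = J_mat"
  shows "det g = 1 \<or> det g = - 1"
proof -
  have "J_mat ** (- J_mat) = (mat 1 :: real^('n + 'n)^('n + 'n))"
    by (simp add: matrix_mult_minus_right J_mat_square)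
  then have "det (J_mat :: real^('n + 'n)^('n + 'n)) \<noteq> 0"
    by (metis det_mul det_I mult_zero_left zero_neq_one)
  moreover have "det g * det (J_mat :: real^('n + 'n)^('n + 'n)) * det g =
      det (J_mat :: real^('n + 'n)^('n + 'n))"
    using arg_cong[OF assms, of det] by (simp add: det_mul)
  ultimately have "(det g)\<^sup>2 = 1" by (simp add: power2_eq_square)
  then show ?thesis by (simp add: power2_eq_1_iff)
qed

lemma infinitesimal_symplectic_iff:
  "Z ** J_mat + J_mat ** transpose Z = 0 \<longleftrightarrow> J_mat ** transpose Z ** J_mat = Z"
proof
  assume "Z ** J_mat + J_mat ** transpose Z = 0"
  then have "J_mat ** transpose Z = - (Z ** J_mat)"
    by (simp add: eq_neg_iff_add_eq_0 add.commute)
  then show "J_mat ** transpose Z ** J_mat = Z"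
    by (simp add: matrix_mult_minus_left matrix_mult_minus_right matrix_mul_assoc[symmetric] J_mat_square)
next
  assume "J_mat ** transpose Z ** J_mat = Z"
  then have "Z ** J_mat = J_mat ** transpose Z ** J_mat ** J_mat"
    by simp
  then show "Z ** J_mat + J_mat ** transpose Z = 0"
    by (simp add: matrix_mult_minus_left matrix_mult_minus_right matrix_mul_assoc[symmetric] J_mat_square)
qed

lemma has_vector_derivative_J_form:
  fixes Z :: "real^('n::finite + 'n)^('n + 'n)"
  shows "((\<lambda>t. matrix_exp (t *\<^sub>R Z) ** J_mat ** transpose (matrix_exp (t *\<^sub>R Z)))
    has_vector_derivative
      matrix_exp (t *\<^sub>R Z) ** (Z ** J_mat + J_mat ** transpose Z) **
        transpose (matrix_exp (t *\<^sub>R Z))) (at t)"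
proof -
  let ?E = "\<lambda>t. matrix_exp (t *\<^sub>R Z)"
  note E' = has_vector_derivative_matrix_exp[of Z t]
  have "((\<lambda>t. ?E t ** J_mat) has_vector_derivative (?E t ** Z) ** J_mat) (at t)"
    by (rule bounded_linear.has_vector_derivative[OF
          bounded_bilinear.bounded_linear_left[OF bounded_bilinear_matrix_mult] E'])
  moreover have "((\<lambda>t. transpose (?E t)) has_vector_derivative transpose (?E t ** Z)) (at t)"
    by (rule bounded_linear.has_vector_derivative[OF bounded_linear_transpose E'])
  ultimately have "((\<lambda>t. (?E t ** J_mat) ** transpose (?E t)) has_vector_derivative
      (?E t ** J_mat) ** transpose (?E t ** Z) + ((?E t ** Z) ** J_mat) ** transpose (?E t)) (at t)"
    by (rule bounded_bilinear.has_vector_derivative[OF bounded_bilinear_matrix_mult])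
  then show ?thesis
    by (simp add: matrix_transpose_mul matrix_mult_add_left matrix_mult_add_right
        matrix_mul_assoc add.commute)
qed

text \<open>With \<open>E(t) = exp(tZ)\<close>, the curve \<open>E J E\<^sup>t\<close> has derivative \<open>E (ZJ + JZ\<^sup>t) E\<^sup>t\<close>.  If \<open>E\<close> stays
  in the group, this vanishes at \<open>t = 0\<close>, where \<open>E = I\<close>.  Conversely, if \<open>ZJ + JZ\<^sup>t = 0\<close>, the
  curve is constant, and \<open>det E\<close>, continuous with values \<open>\<plusminus>1\<close>, keeps its value at \<open>t = 0\<close>.\<close>

lemma lie_algebra_Sp_real:
  "lie_algebra (Sp_real :: (real^('n::finite + 'n)^('n + 'n)) set) =
     {Z. J_mat ** transpose Z ** J_mat = Z}"
proof (intro equalityI subsetI CollectI)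
  fix Z :: "real^('n + 'n)^('n + 'n)"
  assume "Z \<in> lie_algebra Sp_real"
  then have "(\<lambda>t. matrix_exp (t *\<^sub>R Z) ** J_mat ** transpose (matrix_exp (t *\<^sub>R Z))) = (\<lambda>t. J_mat)"
    by (auto simp: lie_algebra_def Sp_real_def)
  with has_vector_derivative_J_form[of Z 0]
  have "((\<lambda>t. J_mat) has_vector_derivative (Z ** J_mat + J_mat ** transpose Z)) (at (0::real))"
    by (simp add: matrix_exp_0)
  then have "Z ** J_mat + J_mat ** transpose Z = 0"
    by (rule vector_derivative_unique_at) (rule has_vector_derivative_const)
  then show "J_mat ** transpose Z ** J_mat = Z"
    by (simp add: infinitesimal_symplectic_iff)
next
  fix Z :: "real^('n + 'n)^('n + 'n)"
  assume "Z \<in> {Z. J_mat ** transpose Z ** J_mat = Z}"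
  then have Z: "Z ** J_mat + J_mat ** transpose Z = 0"
    by (simp add: infinitesimal_symplectic_iff)
  let ?E = "\<lambda>t. matrix_exp (t *\<^sub>R Z)"
  have "((\<lambda>t. ?E t ** J_mat ** transpose (?E t)) has_vector_derivative 0) (at t within UNIV)" for t
    using has_vector_derivative_J_form[of Z t] by (simp add: Z)
  then obtain c where c: "\<And>t. ?E t ** J_mat ** transpose (?E t) = c"
    using has_vector_derivative_zero_constant[of UNIV "\<lambda>t. ?E t ** J_mat ** transpose (?E t)"]
    by auto
  moreover have "c = J_mat"
    using c[of 0] by (simp add: matrix_exp_0)
  ultimately have J: "?E t ** J_mat ** transpose (?E t) = J_mat" for t
    by simp
  have "continuous_on UNIV ?E"
    using has_vector_derivative_matrix_exp[of Z]
    by (meson continuous_at_imp_continuous_on has_vector_derivative_continuous)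
  then have "continuous_on UNIV (\<lambda>t. det (?E t))"
    unfolding det_def by (intro continuous_intros) auto
  moreover have "range (\<lambda>t. det (?E t)) \<subseteq> {1, -1}"
    using det_J_preserving[OF J] by blast
  then have "finite (range (\<lambda>t. det (?E t)))"
    by (rule finite_subset) simp
  ultimately have "(\<lambda>t. det (?E t)) constant_on UNIV"
    by (intro continuous_finite_range_constant connected_UNIV)
  then have "det (?E t) = 1" for t
    unfolding constant_on_def by (metis UNIV_I det_I matrix_exp_0 scale_zero_left)
  with J show "Z \<in> lie_algebra Sp_real"
    by (simp add: lie_algebra_def Sp_real_def)
qed

lemma Sp_real_mult: "g \<in> Sp_real \<Longrightarrow> h \<in> Sp_real \<Longrightarrow> g ** h \<in> Sp_real"
proof -
  assume g: "g \<in> Sp_real" and h: "h \<in> Sp_real"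
  have "(g ** h) ** J_mat ** transpose (g ** h) = g ** (h ** J_mat ** transpose h) ** transpose g"
    by (simp add: matrix_transpose_mul matrix_mul_assoc)
  then show "g ** h \<in> Sp_real"
    using g h by (simp add: Sp_real_def det_mul)
qed

lemma subspace_lie_algebra_Sp_real:
  "subspace (lie_algebra (Sp_real :: (real^('n::finite + 'n)^('n + 'n)) set))"
  unfolding lie_algebra_Sp_real
  by (rule subspaceI)
     (simp_all add: transpose_scalar linear_add[OF bounded_linear.linear[OF bounded_linear_transpose]]
      linear_0[OF bounded_linear.linear[OF bounded_linear_transpose]]
      matrix_mult_add_left matrix_mult_add_right matrix_mult_scaleR_left matrix_mult_scaleR_right)

section \<open>The functions as restrictions of linear forms\<close>

definition join_vec :: "complex^'m \<Rightarrow> complex^'n \<Rightarrow> complex^('m + 'n)" where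
  "join_vec a b = (\<chi> i. case i of Inl k \<Rightarrow> a $ k | Inr k \<Rightarrow> b $ k)"

lemma join_vec_nth [simp]: "join_vec a b $ Inl k = a $ k" "join_vec a b $ Inr k = b $ k"
  by (simp_all add: join_vec_def)

text \<open>These vectors form the eigenspace of \<open>J\<close> for the eigenvalue \<open>i\<close>, a Lagrangian subspace of
  \<open>C\<^bsup>2n\<^esup>\<close>.\<close>

definition isotropic_vec :: "complex^'n \<Rightarrow> complex^('n + 'n)" where
  "isotropic_vec v = join_vec v (\<chi> k. \<i> * v $ k)"

lemma isotropic_vec_nth [simp]:
  "isotropic_vec v $ Inl k = v $ k" "isotropic_vec v $ Inr k = \<i> * v $ k"
  by (simp_all add: isotropic_vec_def)

lemma isotropic_vec_dot: "(\<Sum>i\<in>UNIV. isotropic_vec v $ i * isotropic_vec w $ i) = 0"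
  for v w :: "complex^'n"
proof -
  have "\<i> * x * (\<i> * y) = - (x * y)" for x y
    by (metis i_squared mult.assoc mult.left_commute mult_minus1)
  then show ?thesis
    by (simp add: sum_UNIV_Plus sum_negf)
qed

text \<open>As \<open>J (v, iv)\<^sup>t = (iv, -v)\<^sup>t = i (v, iv)\<^sup>t\<close>.\<close>

lemma J_mat_isotropic_vec:
  "matrix_pairing \<beta> (isotropic_vec v) J_mat = \<i> * matrix_pairing \<beta> (isotropic_vec v) (mat 1)"
  for v :: "complex^'n"
proof -
  have J: "(\<Sum>j\<in>UNIV. of_real (J_mat $ i $ j) * isotropic_vec v $ j) = \<i> * isotropic_vec v $ i"
    for i :: "'n + 'n"
    by (cases i)
       (simp_all add: sum_UNIV_Plus J_mat_entries if_distrib[where f = of_real]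
        if_distrib[where f = "\<lambda>x. x * _"] cong: if_cong)
  have one: "(\<Sum>j\<in>UNIV. of_real (mat 1 $ i $ j) * isotropic_vec v $ j) = isotropic_vec v $ i"
    for i :: "'n + 'n"
    by (simp add: mat_def if_distrib[where f = of_real]
        if_distrib[where f = "\<lambda>x. x * _"] cong: if_cong)
  show ?thesis
    unfolding matrix_pairing_def mult.assoc sum_distrib_left[symmetric] J one
    by (simp add: sum_distrib_left ac_simps)
qed

text \<open>The trace of \<open>a\<^sup>t v X\<^sup>t\<close> is \<open>a X v\<^sup>t\<close>, and \<open>(x + iy) v\<^sup>t\<close> is the row of blocks \<open>(x, y)\<close> applied
  to \<open>(v, iv)\<^sup>t\<close>; likewise for the lower blocks.\<close>

lemma \<phi>_Sp_eq_matrix_pairing: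
  assumes "g \<in> Sp_real"
  shows "\<phi>_Sp a b v g = matrix_pairing (join_vec a b) (isotropic_vec v) g"
proof -
  have "\<phi>_Sp a b v g =
    (\<Sum>i\<in>UNIV. \<Sum>k\<in>UNIV. a $ i * v $ k * Complex (g $ Inl i $ Inl k) (g $ Inl i $ Inr k)) +
    (\<Sum>i\<in>UNIV. \<Sum>k\<in>UNIV. b $ i * v $ k * Complex (g $ Inr i $ Inl k) (g $ Inr i $ Inr k))"
    using assms by (simp add: \<phi>_Sp_def trace_def matrix_matrix_mult_def transpose_def outer_def
      complex_matrix_def block_x_def block_y_def block_z_def block_w_def sum.distrib)
  also have "\<dots> = matrix_pairing (join_vec a b) (isotropic_vec v) g"
    by (simp add: matrix_pairing_def sum_UNIV_Plus Complex_eq sum.distrib algebra_simps)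
  finally show ?thesis .
qed

section \<open>The eigenfamily\<close>

lemma function_space_\<E>_Sp: "function_space_on Sp_real (\<E>_Sp a b)"
proof -
  have add: "(\<lambda>p\<in>Sp_real. \<phi>_Sp a b v p + \<phi>_Sp a b w p) = \<phi>_Sp a b (v + w)" for v w
  proof
    show "(\<lambda>p\<in>Sp_real. \<phi>_Sp a b v p + \<phi>_Sp a b w p) g = \<phi>_Sp a b (v + w) g" for g
    proof (cases "g \<in> Sp_real")
      case True
      then show ?thesis
        by (simp add: \<phi>_Sp_eq_matrix_pairing)
           (simp add: matrix_pairing_def sum_UNIV_Plus sum.distrib algebra_simps)
    qed (simp add: \<phi>_Sp_def)
  qed
  have scale: "(\<lambda>p\<in>Sp_real. c * \<phi>_Sp a b v p) = \<phi>_Sp a b (c *s v)" for c v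
  proof
    show "(\<lambda>p\<in>Sp_real. c * \<phi>_Sp a b v p) g = \<phi>_Sp a b (c *s v) g" for g
    proof (cases "g \<in> Sp_real")
      case True
      then show ?thesis
        by (simp add: \<phi>_Sp_eq_matrix_pairing)
           (simp add: matrix_pairing_def sum_UNIV_Plus sum.distrib sum_distrib_left algebra_simps)
    qed (simp add: \<phi>_Sp_def)
  qed
  have zero: "(\<lambda>p\<in>Sp_real. 0) \<in> \<E>_Sp a b"
    using scale[of 0 0] by (auto simp: \<E>_Sp_def)
  show ?thesis
    unfolding function_space_on_def
  proof (intro conjI ballI allI)
    show "\<E>_Sp a b \<subseteq> extensional Sp_real"
      by (auto simp: \<E>_Sp_def \<phi>_Sp_def)
  qed (use zero add scale in \<open>auto simp: \<E>_Sp_def\<close>)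
qed

theorem theorem6p3:
  fixes a b :: "complex^'n"
  assumes "a \<noteq> 0" and "b \<noteq> 0"
  shows "function_space_on Sp_real (\<E>_Sp a b) \<and> eigenfamily_on Sp_real (\<E>_Sp a b)"
proof
  show "function_space_on Sp_real (\<E>_Sp a b)"
    by (rule function_space_\<E>_Sp)
  let ?L = "\<lambda>v. matrix_pairing (join_vec a b) (isotropic_vec v)"
  let ?B = "lie_basis (Sp_real :: (real^('n + 'n)^('n + 'n)) set)"
  have basis: "lie_orthonormal_basis Sp_real ?B"
    by (rule lie_basis_orthonormal[OF subspace_lie_algebra_Sp_real])
  then have B: "Z \<in> lie_algebra Sp_real" if "Z \<in> ?B" for Z
    using that span_base[of Z ?B] basis by (simp add: lie_orthonormal_basis_def)
  note linear = bounded_linear_matrix_pairing \<phi>_Sp_eq_matrix_pairing Sp_real_mult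
  note basis_sum = transpose_J_mat J_mat_square basis lie_algebra_Sp_real
  have "tension Sp_real (\<phi>_Sp a b v) p = (1/2) * \<phi>_Sp a b v p" if p: "p \<in> Sp_real" for v p
  proof -
    have "tension Sp_real (\<phi>_Sp a b v) p = (\<Sum>Z\<in>?B. ?L v (p ** Z ** Z))"
      unfolding tension_def by (intro sum.cong refl lie_deriv2_linear[OF linear p] B)
    also have "\<dots> = ?L v (p ** (\<Sum>Z\<in>?B. Z ** Z))"
      by (simp add: bounded_bilinear.sum_right[OF bounded_bilinear_matrix_mult] matrix_mul_assoc
          linear_sum[OF bounded_linear.linear[OF bounded_linear_matrix_pairing]])
    also have "\<dots> = (1/2) * ?L v p"
      unfolding orthonormal_sum_square[OF basis_sum] matrix_mult_scaleR_right
        linear_scale[OF bounded_linear.linear[OF bounded_linear_matrix_pairing]]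
        scaleR_conv_of_real[where 'a = complex] by simp
    finally show ?thesis by (simp add: \<phi>_Sp_eq_matrix_pairing p)
  qed
  moreover have "conformality Sp_real (\<phi>_Sp a b v) (\<phi>_Sp a b w) p =
      (- 1/2) * \<phi>_Sp a b v p * \<phi>_Sp a b w p" if p: "p \<in> Sp_real" for v w p
  proof -
    \<comment> \<open>The row vector \<open>\<alpha>p\<close> absorbs the point \<open>p\<close>, so that left invariance reduces the sum to
      the identity element.\<close>
    define \<beta> where "\<beta> = (\<chi> k. \<Sum>i\<in>UNIV. join_vec a b $ i * of_real (p $ i $ k))"
    have \<beta>: "?L v (p ** M) = matrix_pairing \<beta> (isotropic_vec v) M" for v M
      unfolding \<beta>_def by (rule matrix_pairing_mult)
    have "conformality Sp_real (\<phi>_Sp a b v) (\<phi>_Sp a b w) p =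
        (\<Sum>Z\<in>?B. ?L v (p ** Z) * ?L w (p ** Z))"
      unfolding conformality_def
      by (intro sum.cong refl arg_cong2[where f = "(*)"] lie_deriv_linear[OF linear p] B)
    also have "\<dots> = (1/2) *
        (matrix_pairing \<beta> (isotropic_vec v) J_mat * matrix_pairing \<beta> (isotropic_vec w) J_mat)"
      unfolding \<beta> orthonormal_sum_pairing[OF basis_sum] isotropic_vec_dot by simp
    also have "\<dots> = (- 1/2) * ?L v (p ** mat 1) * ?L w (p ** mat 1)"
      unfolding \<beta> J_mat_isotropic_vec by (simp add: algebra_simps)
    finally show ?thesis by (simp add: \<phi>_Sp_eq_matrix_pairing p)
  qed
  moreover have "twice_lie_differentiable Sp_real (\<phi>_Sp a b v)" for v
    by (rule twice_lie_differentiable_linear[OF linear])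
  ultimately show "eigenfamily_on Sp_real (\<E>_Sp a b)"
    unfolding eigenfamily_on_def \<E>_Sp_def by blast
qed

end
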